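(* Let $K=2$, $0<v_1<v_2$, $\eta=v_1/v_2$, and let $\alpha^*\in[0,1]$ be the probability of the high value $v_2$ in the aggregated market. The minimum consumer utility across all segmentations, $\beta\mapsto\min\{u_c:(u_c,u_p)\in\mathcal S_\beta\}$, is an increasing function of $\beta$ over the interval $[0,\min\{2\eta,2(1-\eta)\}]$ if and only if $\eta\ge1/2$.
   Context: Values are $\mathcal V=\{v_1,v_2\}$. A market is a probability distribution $x$ on $\mathcal V$, identified with $\alpha=x(v_2)\in[0,1]$; $\mathcal X$ is the set of all markets and $\mathrm{Unif}(\mathcal X)$ the uniform distribution on it (i.e. $\alpha$ uniform on $[0,1]$). The aggregated market is $x^*=(1-\alpha^*,\alpha^* )$. A segmentation is a finitely supported probability distribution $\sigma$ on $\mathcal X$ with $\sum_x\sigma(x)x=x^*$; $\Sigma$ is the set of segmentations. For a price $p\ge0$ and market $x$: $\mathcal U_p(p,x)=p\sum_k x(v_k)\mathbf 1(p\le v_k)$ (producer) and $\mathcal U_c(p,x)=\sum_k x(v_k)(v_k-p)\mathbf 1(p\le v_k)$ (consumer). Privacy mechanism with parameter $\beta\in[0,1]$: $\mathcal M_\beta(x)$ equals $x$ with probability $1-\beta$ and, with probability $\beta$, is a draw from $\mathrm{Unif}(\mathcal X)$. The producer has prior $\mathrm{Unif}(\mathcal X)$; after observing $\hat x$ the posterior is $\pi_\beta(\cdot|\hat x)=(1-\beta)\delta_{\hat x}+\beta\,\mathrm{Unif}(\mathcal X)$. Put $\mathcal U_p(p|\hat x)=\mathbb E_{x\sim\pi_\beta(\cdot|\hat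 x)}[\mathcal U_p(p,x)]$. A price $p$ is optimal given $\hat x$ if $\mathcal U_p(p|\hat x)\ge\mathcal U_p(p'|\hat x)$ for all $p'\ge0$ (optimal prices lie in $\mathcal V$). An optimal pricing rule is a map $\phi:\mathcal X\to\Delta(\mathcal V)$ such that for each $\hat x$ the support of $\phi(\hat x)$ consists only of prices optimal given $\hat x$. For $\bullet\in\{p,c\}$ let $U_\bullet^\phi(x)=\mathbb E_{\hat x\sim\mathcal M_\beta(x)}\mathbb E_{q\sim\phi(\hat x)}[\mathcal U_\bullet(q,x)]$. Then $\mathcal S_\beta$ is the set of (consumer, producer) utility pairs $\big(\sum_x\sigma(x)U_c^\phi(x),\ \sum_x\sigma(x)U_p^\phi(x)\big)$ over all $\sigma\in\Sigma$ and all optimal pricing rules $\phi$ (for parameter $\beta$).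
   Formalization: The case α*=0 (minimum identically 0, so the equivalence fails) is excluded, and monotonicity is asserted on the interval without β=1, which matters only at η=1/2, where the minimum drops to 0 at β=1. *)

theory Defs
  imports "HOL-Probability.Probability"
begin

text \<open>
  A market is given by the probability \<open>\<alpha> \<in> {0..1}\<close> of the high value \<open>v2\<close>;
  \<open>market v1 v2 \<alpha>\<close> is the corresponding distribution on the values.
\<close>

definition market :: "real \<Rightarrow> real \<Rightarrow> real \<Rightarrow> real pmf" where
  "market v1 v2 \<alpha> = map_pmf (\<lambda>high. if high then v2 else v1) (bernoulli_pmf \<alpha>)"

definition producer_utility :: "real set \<Rightarrow> real \<Rightarrow> real pmf \<Rightarrow> real" where
  "producer_utility V p x = p * (\<Sum>v\<in>V. pmf x v * of_bool (p \<le> v))"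

definition consumer_utility :: "real set \<Rightarrow> real \<Rightarrow> real pmf \<Rightarrow> real" where
  "consumer_utility V p x = (\<Sum>v\<in>V. pmf x v * (v - p) * of_bool (p \<le> v))"

text \<open>
  The underlying space is \<open>{0..1}\<close> rather than the whole line, so that the values of a pricing
  rule outside \<open>{0..1}\<close> affect neither measurability nor integrals.
\<close>

definition market_space :: "real measure" where
  "market_space = restrict_space borel {0..1}"

definition unif_market :: "real measure" where
  "unif_market = uniform_measure (restrict_space lborel {0..1}) {0..1}"

definition mechanism :: "real \<Rightarrow> real \<Rightarrow> real measure" where
  "mechanism \<beta> x =
     measure_pmf (bernoulli_pmf \<beta>) \<bind>
       (\<lambda>noise. if noise then unif_market else return market_space x)"

text \<open>
  For the uniform prior, the posterior given \<open>xh\<close> is again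
  \<open>(1 - \<beta>) \<delta>\<^bsub>xh\<^esub> + \<beta> Unif\<close>, i.e. the same mixture as \<open>mechanism \<beta> xh\<close>.
\<close>

definition posterior :: "real \<Rightarrow> real \<Rightarrow> real measure" where
  "posterior \<beta> xh = mechanism \<beta> xh"

definition posterior_producer_utility :: "real \<Rightarrow> real \<Rightarrow> real \<Rightarrow> real \<Rightarrow> real \<Rightarrow> real" where
  "posterior_producer_utility v1 v2 \<beta> p xh =
     (\<integral>x. producer_utility {v1, v2} p (market v1 v2 x) \<partial>posterior \<beta> xh)"

definition optimal_price :: "real \<Rightarrow> real \<Rightarrow> real \<Rightarrow> real \<Rightarrow> real \<Rightarrow> bool" where
  "optimal_price v1 v2 \<beta> xh p \<longleftrightarrow>
     p \<ge> 0 \<and> (\<forall>p'\<ge>0. posterior_producer_utility v1 v2 \<beta> p' xh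
                     \<le> posterior_producer_utility v1 v2 \<beta> p xh)"

text \<open>
  Measurability is what makes the expectation over \<open>mechanism \<beta> x\<close> of a \<open>\<phi>\<close>-dependent
  quantity meaningful.
\<close>

definition optimal_pricing_rule :: "real \<Rightarrow> real \<Rightarrow> real \<Rightarrow> (real \<Rightarrow> real pmf) \<Rightarrow> bool" where
  "optimal_pricing_rule v1 v2 \<beta> \<phi> \<longleftrightarrow>
     (\<forall>xh\<in>{0..1}. set_pmf (\<phi> xh) \<subseteq> {v1, v2} \<and>
        (\<forall>q\<in>set_pmf (\<phi> xh). optimal_price v1 v2 \<beta> xh q)) \<and>
     (\<forall>v\<in>{v1, v2}. (\<lambda>xh. pmf (\<phi> xh) v) \<in> borel_measurable market_space)"

text \<open>
  Under the identification of markets with \<open>\<alpha>\<close>, the weights of a segmentation average the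
  markets to the aggregated market iff they average the \<open>\<alpha>\<close>s to \<open>\<alpha>s\<close>.
\<close>

definition segmentation :: "real \<Rightarrow> real pmf \<Rightarrow> bool" where
  "segmentation \<alpha>s \<sigma> \<longleftrightarrow>
     finite (set_pmf \<sigma>) \<and> set_pmf \<sigma> \<subseteq> {0..1} \<and> (\<Sum>x\<in>set_pmf \<sigma>. pmf \<sigma> x * x) = \<alpha>s"

definition expected_utility ::
  "(real \<Rightarrow> real pmf \<Rightarrow> real) \<Rightarrow> real \<Rightarrow> real \<Rightarrow> real \<Rightarrow> (real \<Rightarrow> real pmf) \<Rightarrow> real \<Rightarrow> real" where
  "expected_utility U v1 v2 \<beta> \<phi> x =
     (\<integral>xh. measure_pmf.expectation (\<phi> xh) (\<lambda>q. U q (market v1 v2 x)) \<partial>mechanism \<beta> x)"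

definition utility_pairs :: "real \<Rightarrow> real \<Rightarrow> real \<Rightarrow> real \<Rightarrow> (real \<times> real) set" where
  "utility_pairs v1 v2 \<alpha>s \<beta> =
     {(\<Sum>x\<in>set_pmf \<sigma>. pmf \<sigma> x * expected_utility (consumer_utility {v1, v2}) v1 v2 \<beta> \<phi> x,
       \<Sum>x\<in>set_pmf \<sigma>. pmf \<sigma> x * expected_utility (producer_utility {v1, v2}) v1 v2 \<beta> \<phi> x)
      | \<sigma> \<phi>. segmentation \<alpha>s \<sigma> \<and> optimal_pricing_rule v1 v2 \<beta> \<phi>}"

definition consumer_utilities :: "real \<Rightarrow> real \<Rightarrow> real \<Rightarrow> real \<Rightarrow> real set" where
  "consumer_utilities v1 v2 \<alpha>s \<beta> = {uc. \<exists>up. (uc, up) \<in> utility_pairs v1 v2 \<alpha>s \<beta>}"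

text \<open>Only meaningful when the minimum is attained.\<close>

definition min_consumer_utility :: "real \<Rightarrow> real \<Rightarrow> real \<Rightarrow> real \<Rightarrow> real" where
  "min_consumer_utility v1 v2 \<alpha>s \<beta> = (LEAST uc. uc \<in> consumer_utilities v1 v2 \<alpha>s \<beta>)"

end

theory Submission imports Defs begin

text \<open>
  Only sales at the low price leave surplus to consumers, and by Bayes the low price is forced
  exactly at the signals \<open>y\<close> with posterior mean \<open>(1 - \<beta>) y + \<beta> / 2 < \<eta>\<close>. Noise therefore guarantees
  consumers at least \<open>(v2 - v1) \<alpha>s \<beta> P\<close>, where \<open>P\<close> is the uniform probability of such signals. Full
  revelation, with ties broken towards the high price, attains this bound: the true signal is 0,
  where there is no surplus, or 1, where the price is high as long as \<open>\<beta> \<le> 2 (1 - \<eta>)\<close>. For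
  \<open>\<beta> < 1\<close> the value is proportional to
  \<open>\<beta> (\<eta> - \<beta> / 2) / (1 - \<beta>) = (\<eta> - 1/2) (1 / (1 - \<beta>) - 1) + \<beta> / 2\<close>, which is strictly
  increasing if \<open>\<eta> \<ge> 1/2\<close>; if \<open>\<eta> < 1/2\<close> it is positive at \<open>\<eta>\<close> and vanishes at \<open>2 \<eta>\<close>.
\<close>

section \<open>The uniform market and integration against the mechanism\<close>

lemma space_market_space [simp]: "space market_space = {0..1}"
  by (simp add: market_space_def space_restrict_space)

lemma sets_unif_market [simp, measurable_cong]: "sets unif_market = sets market_space"
  by (simp add: unif_market_def market_space_def sets_restrict_space)

lemma space_unif_market [simp]: "space unif_market = {0..1}"
  using sets_eq_imp_space_eq[OF sets_unif_market] by simp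

lemma emeasure_unit_interval: "emeasure (restrict_space lborel {0..1::real}) {0..1} = 1"
  by (simp add: emeasure_restrict_space)

lemma prob_space_unif_market: "prob_space unif_market"
  unfolding unif_market_def by (rule prob_space_uniform_measure) (simp_all add: emeasure_unit_interval)

text \<open>The normalising constant is 1; this turns integrals and measures over
  \<open>unif_market\<close> into Lebesgue ones.\<close>

lemma unif_market_eq: "unif_market = restrict_space lborel {0..1}"
proof (rule measure_eqI)
  fix A assume "A \<in> sets unif_market"
  then have A: "A \<in> sets (restrict_space lborel {0..1::real})"
    by (simp add: unif_market_def)
  then have "A \<subseteq> {0..1}"
    using sets.sets_into_space[OF A] by (simp add: space_restrict_space)
  with A show "emeasure unif_market A = emeasure (restrict_space lborel {0..1}) A"
    unfolding unif_market_def
    by (subst emeasure_uniform_measure)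
       (auto simp: emeasure_unit_interval Int_absorb1 divide_ennreal_def sets_restrict_space_iff)
qed (simp add: unif_market_def)

text \<open>Needed for \<open>integral_bind\<close>. The coin lives on a discrete space, so it only
  remains to check that both branches are subprobability measures.\<close>

lemma mechanism_kernel:
  assumes "x \<in> {0..1}"
  shows "(\<lambda>noise. if noise then unif_market else return market_space x)
    \<in> measure_pmf (bernoulli_pmf \<beta>) \<rightarrow>\<^sub>M subprob_algebra market_space"
  using assms prob_space_unif_market prob_space_return[of x market_space]
  by (auto simp: space_subprob_algebra prob_space_imp_subprob_space)

lemma space_mechanism:
  assumes "x \<in> {0..1}"
  shows "space (mechanism \<beta> x) = {0..1}"
  unfolding mechanism_def by (subst space_bind[where N=market_space]) auto

text \<open>Condition on the coin. The formula is applied twice: over markets, for the posterior of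
  the producer, and over signals, for the utility of the consumers.\<close>

lemma integral_mechanism:
  fixes f :: "real \<Rightarrow> real"
  assumes x: "x \<in> {0..1}" and \<beta>: "0 \<le> \<beta>" "\<beta> \<le> 1"
    and f: "f \<in> borel_measurable market_space" and B: "\<And>y. y \<in> {0..1} \<Longrightarrow> \<bar>f y\<bar> \<le> B"
  shows "(\<integral>y. f y \<partial>mechanism \<beta> x) = (1 - \<beta>) * f x + \<beta> * (\<integral>y. f y \<partial>unif_market)"
proof -
  have "(\<integral>y. f y \<partial>mechanism \<beta> x) =
    (\<integral>noise. (\<integral>y. f y \<partial>(if noise then unif_market else return market_space x)) \<partial>bernoulli_pmf \<beta>)"
    unfolding mechanism_def
  proof (rule integral_bind[OF f, where B = B and B' = 1])
    show "AE noise in bernoulli_pmf \<beta>. emeasure (if noise then unif_market else return market_space x)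
        (space (if noise then unif_market else return market_space x)) \<le> ennreal 1"
      using x prob_space.emeasure_space_1[OF prob_space_unif_market]
        prob_space.emeasure_space_1[OF prob_space_return[of x market_space]] by auto
  qed (use mechanism_kernel[OF x] B in auto)
  also have "\<dots> = (1 - \<beta>) * f x + \<beta> * (\<integral>y. f y \<partial>unif_market)"
    using \<beta> x f by (simp add: integral_return)
  finally show ?thesis .
qed

section \<open>Utilities in a two-value market\<close>

lemma pmf_market:
  assumes "v1 < v2" "x \<in> {0..1}"
  shows "pmf (market v1 v2 x) v2 = x" "pmf (market v1 v2 x) v1 = 1 - x"
proof -
  have "(\<lambda>high. if high then v2 else v1) -` {v2} = {True}"
    "(\<lambda>high. if high then v2 else v1) -` {v1} = {False}"
    using assms(1) by (auto split: if_splits)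
  then show "pmf (market v1 v2 x) v2 = x" "pmf (market v1 v2 x) v1 = 1 - x"
    using assms by (simp_all add: market_def pmf_map measure_pmf_single)
qed

lemma producer_utility_market:
  assumes "v1 < v2" "x \<in> {0..1}"
  shows "producer_utility {v1, v2} p (market v1 v2 x) =
    (if p \<le> v1 then p else if p \<le> v2 then p * x else 0)"
  using assms by (auto simp: producer_utility_def pmf_market)

lemma consumer_utility_market:
  assumes "v1 < v2" "x \<in> {0..1}"
  shows "consumer_utility {v1, v2} v1 (market v1 v2 x) = (v2 - v1) * x"
    "consumer_utility {v1, v2} v2 (market v1 v2 x) = 0"
  using assms by (auto simp: consumer_utility_def pmf_market)

section \<open>Posterior revenue and optimal prices\<close>

lemma integral_unif_market_id: "(\<integral>x. x \<partial>unif_market) = 1 / 2"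
proof -
  have "(\<integral>x. x \<partial>unif_market) = (\<integral>x. x ^ 1 * indicator {0..1} x \<partial>lborel)"
    by (simp add: unif_market_eq integral_restrict_space mult.commute)
  also have "\<dots> = 1 / 2"
    by (subst integral_power) simp_all
  finally show ?thesis .
qed

lemma measure_unif_market_atLeastLessThan:
  assumes "t \<in> {0..1}"
  shows "measure unif_market {0..<t} = t"
  using assms by (subst unif_market_eq, subst measure_restrict_space) auto

lemma market_space_measurable_id [measurable]: "(\<lambda>x. x) \<in> borel_measurable market_space"
  by (simp add: market_space_def measurable_restrict_space1)

text \<open>At a fixed price, revenue is affine in the market, so the posterior enters only through
  its mean; the uniform part has mean 1/2.\<close>

lemma posterior_producer_utility_eq:
  assumes v: "v1 < v2" and xh: "xh \<in> {0..1}" and \<beta>: "0 \<le> \<beta>" "\<beta> \<le> 1"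
  shows "posterior_producer_utility v1 v2 \<beta> p xh =
    (if p \<le> v1 then p else if p \<le> v2 then p * ((1 - \<beta>) * xh + \<beta> / 2) else 0)"
proof -
  interpret U: prob_space unif_market by (rule prob_space_unif_market)
  let ?f = "\<lambda>x. if p \<le> v1 then p else if p \<le> v2 then p * x else 0"
  have "posterior_producer_utility v1 v2 \<beta> p xh = (\<integral>x. ?f x \<partial>mechanism \<beta> xh)"
    unfolding posterior_producer_utility_def posterior_def
    by (rule Bochner_Integration.integral_cong)
       (use v xh in \<open>simp_all add: space_mechanism producer_utility_market\<close>)
  also have "\<dots> = (1 - \<beta>) * ?f xh + \<beta> * (\<integral>x. ?f x \<partial>unif_market)"
    by (rule integral_mechanism[where B = "\<bar>p\<bar>"])
       (use xh \<beta> in \<open>auto simp: abs_mult mult_left_le\<close>)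
  also have "\<dots> = (if p \<le> v1 then p else if p \<le> v2 then p * ((1 - \<beta>) * xh + \<beta> / 2) else 0)"
    by (simp add: integral_unif_market_id U.prob_space[simplified] algebra_simps)
  finally show ?thesis .
qed

text \<open>Revenue is nondecreasing in the price up to \<open>v1\<close> and again between
  \<open>v1\<close> and \<open>v2\<close>, so only these two prices compete.\<close>

lemma optimal_price_low_iff:
  assumes v: "0 < v1" "v1 < v2" and xh: "xh \<in> {0..1}" and \<beta>: "0 \<le> \<beta>" "\<beta> \<le> 1"
  shows "optimal_price v1 v2 \<beta> xh v1 \<longleftrightarrow> v2 * ((1 - \<beta>) * xh + \<beta> / 2) \<le> v1"
proof -
  define m where "m = (1 - \<beta>) * xh + \<beta> / 2"
  have "m \<ge> 0" using xh \<beta> by (simp add: m_def)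
  then have "p * m \<le> v2 * m" if "p \<le> v2" for p
    using that by (simp add: mult_right_mono)
  moreover have "(\<forall>p\<ge>0. (if p \<le> v1 then p else if p \<le> v2 then p * m else 0) \<le> v1) \<Longrightarrow> v2 * m \<le> v1"
    using v by (auto dest: spec[of _ v2])
  ultimately show ?thesis
    using v unfolding optimal_price_def posterior_producer_utility_eq[OF v(2) xh \<beta>] m_def[symmetric]
    by (auto simp: not_le) (smt (verit))
qed

lemma optimal_price_high_iff:
  assumes v: "0 < v1" "v1 < v2" and xh: "xh \<in> {0..1}" and \<beta>: "0 \<le> \<beta>" "\<beta> \<le> 1"
  shows "optimal_price v1 v2 \<beta> xh v2 \<longleftrightarrow> v1 \<le> v2 * ((1 - \<beta>) * xh + \<beta> / 2)"
proof -
  define m where "m = (1 - \<beta>) * xh + \<beta> / 2"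
  have "m \<ge> 0" using xh \<beta> by (simp add: m_def)
  then have "p * m \<le> v2 * m" if "p \<le> v2" for p
    using that by (simp add: mult_right_mono)
  moreover have "(\<forall>p\<ge>0. (if p \<le> v1 then p else if p \<le> v2 then p * m else 0) \<le> v2 * m) \<Longrightarrow> v1 \<le> v2 * m"
    using v by (auto dest: spec[of _ v1])
  ultimately show ?thesis
    using v \<open>m \<ge> 0\<close> unfolding optimal_price_def posterior_producer_utility_eq[OF v(2) xh \<beta>] m_def[symmetric]
    by auto
qed

section \<open>Consumer utility and the signals that force the low price\<close>

text \<open>Surplus arises only when a high-value buyer faces the low price. The noise integral is
  the same for every \<open>x\<close>, so no segmentation can change it.\<close>

lemma expected_consumer_utility_eq:
  assumes v: "0 < v1" "v1 < v2" and x: "x \<in> {0..1}" and \<beta>: "0 \<le> \<beta>" "\<beta> \<le> 1"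
    and \<phi>: "optimal_pricing_rule v1 v2 \<beta> \<phi>"
  shows "expected_utility (consumer_utility {v1, v2}) v1 v2 \<beta> \<phi> x =
    (v2 - v1) * x * ((1 - \<beta>) * pmf (\<phi> x) v1 + \<beta> * (\<integral>xh. pmf (\<phi> xh) v1 \<partial>unif_market))"
proof -
  let ?f = "\<lambda>xh. (v2 - v1) * x * pmf (\<phi> xh) v1"
  have "measure_pmf.expectation (\<phi> xh) (\<lambda>q. consumer_utility {v1, v2} q (market v1 v2 x)) = ?f xh"
    if "xh \<in> {0..1}" for xh
  proof -
    have "set_pmf (\<phi> xh) \<subseteq> {v1, v2}"
      using \<phi> that by (auto simp: optimal_pricing_rule_def)
    then show ?thesis
      using v x by (subst integral_measure_pmf[of "{v1, v2}"]) (auto simp: consumer_utility_market)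
  qed
  then have "expected_utility (consumer_utility {v1, v2}) v1 v2 \<beta> \<phi> x = (\<integral>xh. ?f xh \<partial>mechanism \<beta> x)"
    unfolding expected_utility_def
    by (intro Bochner_Integration.integral_cong) (use x in \<open>simp_all add: space_mechanism\<close>)
  also have "\<dots> = (1 - \<beta>) * ?f x + \<beta> * (\<integral>xh. ?f xh \<partial>unif_market)"
  proof (rule integral_mechanism[where B = "(v2 - v1) * x"])
    show "?f \<in> borel_measurable market_space"
      using \<phi> by (auto simp: optimal_pricing_rule_def)
  qed (use v x \<beta> in \<open>auto simp: abs_mult pmf_le_1 mult_left_le\<close>)
  also have "\<dots> = (v2 - v1) * x * ((1 - \<beta>) * pmf (\<phi> x) v1 + \<beta> * (\<integral>xh. pmf (\<phi> xh) v1 \<partial>unif_market))"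
    by (subst integral_mult_right_zero) (simp only: distrib_left mult.left_commute)
  finally show ?thesis .
qed

text \<open>
  The strict inequality leaves out the tie, where the high price is optimal as well.
\<close>

definition low_signals :: "real \<Rightarrow> real \<Rightarrow> real \<Rightarrow> real set" where
  "low_signals v1 v2 \<beta> = {y\<in>{0..1}. v2 * ((1 - \<beta>) * y + \<beta> / 2) < v1}"

lemma low_signals_Int_unit [simp]: "low_signals v1 v2 \<beta> \<inter> {0..1} = low_signals v1 v2 \<beta>"
  by (auto simp: low_signals_def)

lemma low_signals_measurable [measurable]: "low_signals v1 v2 \<beta> \<in> sets market_space"
proof -
  have "{y\<in>space market_space. v2 * ((1 - \<beta>) * y + \<beta> / 2) < v1} \<in> sets market_space"
    by measurable
  then show ?thesis by (simp add: low_signals_def)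
qed

text \<open>On \<open>low_signals\<close> the high price is strictly worse, so the whole mass must
  sit on \<open>v1\<close>.\<close>

lemma pmf_low_price_ge_indicator:
  assumes v: "0 < v1" "v1 < v2" and xh: "xh \<in> {0..1}" and \<beta>: "0 \<le> \<beta>" "\<beta> \<le> 1"
    and \<phi>: "optimal_pricing_rule v1 v2 \<beta> \<phi>"
  shows "indicator (low_signals v1 v2 \<beta>) xh \<le> pmf (\<phi> xh) v1"
proof (cases "xh \<in> low_signals v1 v2 \<beta>")
  case True
  then have "\<not> optimal_price v1 v2 \<beta> xh v2"
    using optimal_price_high_iff[OF v xh \<beta>] by (simp add: low_signals_def)
  then have "set_pmf (\<phi> xh) \<subseteq> {v1}"
    using \<phi> xh by (fastforce simp: optimal_pricing_rule_def)
  then show ?thesis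
    by (simp add: set_pmf_subset_singleton)
qed simp

section \<open>The lower bound and its attainment\<close>

text \<open>Drop the nonnegative term of the undisturbed signal. What remains is linear in
  \<open>x\<close>, so every segmentation averages it to the same value.\<close>

lemma consumer_utilities_ge:
  assumes v: "0 < v1" "v1 < v2" and \<beta>: "0 \<le> \<beta>" "\<beta> \<le> 1"
    and u: "u \<in> consumer_utilities v1 v2 \<alpha>s \<beta>"
  shows "(v2 - v1) * \<alpha>s * (\<beta> * measure unif_market (low_signals v1 v2 \<beta>)) \<le> u"
proof -
  interpret U: prob_space unif_market by (rule prob_space_unif_market)
  let ?L = "measure unif_market (low_signals v1 v2 \<beta>)"
  let ?E = "expected_utility (consumer_utility {v1, v2}) v1 v2 \<beta>"
  obtain \<sigma> \<phi> where \<sigma>: "segmentation \<alpha>s \<sigma>" and \<phi>: "optimal_pricing_rule v1 v2 \<beta> \<phi>"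
    and u_eq: "u = (\<Sum>x\<in>set_pmf \<sigma>. pmf \<sigma> x * ?E \<phi> x)"
    using u by (auto simp: consumer_utilities_def utility_pairs_def)
  have "?L = (\<integral>xh. indicator (low_signals v1 v2 \<beta>) xh \<partial>unif_market)"
    by simp
  also have "\<dots> \<le> (\<integral>xh. pmf (\<phi> xh) v1 \<partial>unif_market)"
  proof (rule integral_mono)
    show "integrable unif_market (\<lambda>xh. pmf (\<phi> xh) v1)"
      by (rule U.integrable_const_bound[where B = 1])
         (use \<phi> in \<open>auto simp: optimal_pricing_rule_def pmf_le_1 cong: measurable_cong_sets\<close>)
  qed (use pmf_low_price_ge_indicator[OF v _ \<beta> \<phi>] in \<open>auto simp: U.emeasure_eq_measure\<close>)
  finally have L: "?L \<le> (\<integral>xh. pmf (\<phi> xh) v1 \<partial>unif_market)" .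
  have E: "(v2 - v1) * x * (\<beta> * ?L) \<le> ?E \<phi> x" if "x \<in> {0..1}" for x
  proof -
    have "\<beta> * ?L \<le> (1 - \<beta>) * pmf (\<phi> x) v1 + \<beta> * (\<integral>xh. pmf (\<phi> xh) v1 \<partial>unif_market)"
      using L \<beta> by (simp add: add_increasing mult_left_mono)
    then show ?thesis
      unfolding expected_consumer_utility_eq[OF v that \<beta> \<phi>]
      using v that by (intro mult_left_mono) auto
  qed
  have "(v2 - v1) * \<alpha>s * (\<beta> * ?L) = (\<Sum>x\<in>set_pmf \<sigma>. pmf \<sigma> x * ((v2 - v1) * x * (\<beta> * ?L)))"
  proof -
    have "\<alpha>s = (\<Sum>x\<in>set_pmf \<sigma>. pmf \<sigma> x * x)"
      using \<sigma> by (simp add: segmentation_def)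
    then show ?thesis
      by (simp only: sum_distrib_left sum_distrib_right mult.assoc mult.left_commute)
  qed
  also have "\<dots> \<le> u"
    unfolding u_eq using \<sigma> E by (intro sum_mono mult_left_mono) (auto simp: segmentation_def)
  finally show ?thesis .
qed

lemma consumer_utilities_attains:
  assumes v: "0 < v1" "v1 < v2" and \<alpha>s: "0 \<le> \<alpha>s" "\<alpha>s \<le> 1"
    and \<beta>: "0 \<le> \<beta>" "\<beta> \<le> 1" "v1 \<le> v2 * (1 - \<beta> / 2)"
  shows "(v2 - v1) * \<alpha>s * (\<beta> * measure unif_market (low_signals v1 v2 \<beta>))
    \<in> consumer_utilities v1 v2 \<alpha>s \<beta>"
proof -
  let ?A = "low_signals v1 v2 \<beta>"
  let ?E = "expected_utility (consumer_utility {v1, v2}) v1 v2 \<beta>"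
  \<comment> \<open>Charge the low price only where it is forced, and reveal the value of every
    buyer: the market 1 gets weight \<alpha>s and the market 0 the rest.\<close>
  define \<phi> where "\<phi> xh = return_pmf (if xh \<in> ?A then v1 else v2)" for xh
  define \<sigma> :: "real pmf" where "\<sigma> = map_pmf of_bool (bernoulli_pmf \<alpha>s)"
  have pmf_\<phi>: "(\<lambda>xh. pmf (\<phi> xh) v1) = indicator ?A" "(\<lambda>xh. pmf (\<phi> xh) v2) = (\<lambda>xh. 1 - indicator ?A xh)"
    using v by (auto simp: \<phi>_def indicator_def fun_eq_iff)
  have \<phi>: "optimal_pricing_rule v1 v2 \<beta> \<phi>"
    unfolding optimal_pricing_rule_def
  proof (intro conjI ballI)
    fix xh q :: real assume xh: "xh \<in> {0..1}" and "q \<in> set_pmf (\<phi> xh)"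
    then show "optimal_price v1 v2 \<beta> xh q"
      using optimal_price_low_iff[OF v xh \<beta>(1,2)] optimal_price_high_iff[OF v xh \<beta>(1,2)]
      by (auto simp: \<phi>_def low_signals_def split: if_splits)
  next
    fix p assume "p \<in> {v1, v2}"
    then show "(\<lambda>xh. pmf (\<phi> xh) p) \<in> borel_measurable market_space"
      by (auto simp: pmf_\<phi>)
  qed (simp add: \<phi>_def)
  have supp: "set_pmf \<sigma> \<subseteq> {0, 1}"
    by (auto simp: \<sigma>_def)
  have "(of_bool :: bool \<Rightarrow> real) -` {1} = {True}" by (auto simp: of_bool_def split: if_splits)
  then have "pmf \<sigma> 1 = \<alpha>s"
    using \<alpha>s by (simp add: \<sigma>_def pmf_map measure_pmf_single)
  \<comment> \<open>Summing over {0, 1} also covers \<alpha>s = 0 and \<alpha>s = 1, where the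
    support is a single point.\<close>
  then have sum_\<sigma>: "(\<Sum>x\<in>set_pmf \<sigma>. pmf \<sigma> x * (x * c)) = \<alpha>s * c" for c
    by (subst sum.mono_neutral_left[OF _ supp]) (auto simp: set_pmf_eq)
  have "segmentation \<alpha>s \<sigma>"
    using supp finite_subset[OF supp] sum_\<sigma>[of 1] by (auto simp: segmentation_def)
  moreover have "(v2 - v1) * \<alpha>s * (\<beta> * measure unif_market ?A) = (\<Sum>x\<in>set_pmf \<sigma>. pmf \<sigma> x * ?E \<phi> x)"
  proof -
    have E: "?E \<phi> x = x * ((v2 - v1) * (\<beta> * measure unif_market ?A))" if "x \<in> set_pmf \<sigma>" for x
    proof -
      have x: "x = 0 \<or> x = 1" using that supp by auto
      \<comment> \<open>The posterior mean at signal 1 is 1 - \<beta> / 2, which by the last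
        assumption on \<beta> is at least \<open>v1 / v2\<close>.\<close>
      moreover have "1 \<notin> ?A" using \<beta> by (simp add: low_signals_def algebra_simps)
      ultimately have "pmf (\<phi> x) v1 = 0 \<or> x = 0"
        using v by (auto simp: \<phi>_def)
      moreover have "(\<integral>xh. pmf (\<phi> xh) v1 \<partial>unif_market) = measure unif_market ?A"
        using pmf_\<phi>(1) by simp
      ultimately show ?thesis
        using x by (subst expected_consumer_utility_eq[OF v _ \<beta>(1,2) \<phi>]) auto
    qed
    show ?thesis
      by (simp only: E sum_\<sigma> cong: sum.cong) (simp only: mult.left_commute mult.assoc)
  qed
  ultimately show ?thesis
    using \<phi> unfolding consumer_utilities_def utility_pairs_def by blast
qed

section \<open>The threshold signal and monotonicity in the noise level\<close>

text \<open>The low price is forced below a threshold signal. The two upper bounds on \<beta> in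
  terms of \<open>v1 / v2\<close> say exactly that this threshold is at least 0 and at most
  1.\<close>

lemma measure_low_signals:
  assumes v: "0 < v1" "v1 < v2"
    and \<beta>: "\<beta> < 1" "\<beta> \<le> 2 * (v1 / v2)" "\<beta> \<le> 2 * (1 - v1 / v2)"
  shows "measure unif_market (low_signals v1 v2 \<beta>) = (v1 / v2 - \<beta> / 2) / (1 - \<beta>)"
proof -
  define t where "t = (v1 / v2 - \<beta> / 2) / (1 - \<beta>)"
  have t: "t \<in> {0..1}" using \<beta> by (auto simp: t_def le_divide_eq divide_le_eq)
  have "v2 * ((1 - \<beta>) * y + \<beta> / 2) < v1 \<longleftrightarrow> y < t" for y
  proof -
    have "v2 * ((1 - \<beta>) * y + \<beta> / 2) < v1 \<longleftrightarrow> (1 - \<beta>) * y + \<beta> / 2 < v1 / v2"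
      using v by (simp add: less_divide_eq mult.commute)
    also have "\<dots> \<longleftrightarrow> y * (1 - \<beta>) < v1 / v2 - \<beta> / 2"
      by (simp only: less_diff_eq mult.commute)
    also have "\<dots> \<longleftrightarrow> y < t"
      using \<beta> by (simp add: t_def less_divide_eq)
    finally show ?thesis .
  qed
  then have "low_signals v1 v2 \<beta> = {y\<in>{0..1}. y < t}"
    by (simp only: low_signals_def)
  also have "\<dots> = {0..<t}"
    using t by auto
  finally show ?thesis
    using measure_unif_market_atLeastLessThan[OF t] by (simp add: t_def)
qed

text \<open>The first conjunct makes the \<open>LEAST\<close> meaningful; the other two cover both
  readings of "increasing". The point \<beta> = 1 lies in the interval only if \<eta> = 1/2. There
  every signal is a tie and the minimum drops to 0, so monotonicity would fail. With \<alpha>s = 0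
  the minimum would vanish throughout.\<close>

theorem lemma3:
  fixes v1 v2 \<eta> \<alpha>s :: real
  assumes "0 < v1" and "v1 < v2" and "\<eta> = v1 / v2"
    and "0 < \<alpha>s" and "\<alpha>s \<le> 1"
  shows "(\<forall>\<beta>\<in>{0..min (2 * \<eta>) (2 * (1 - \<eta>))}.
            \<exists>m\<in>consumer_utilities v1 v2 \<alpha>s \<beta>. \<forall>u\<in>consumer_utilities v1 v2 \<alpha>s \<beta>. m \<le> u)
       \<and> (mono_on ({0..min (2 * \<eta>) (2 * (1 - \<eta>))} - {1}) (min_consumer_utility v1 v2 \<alpha>s)
            \<longleftrightarrow> \<eta> \<ge> 1 / 2)
       \<and> (strict_mono_on ({0..min (2 * \<eta>) (2 * (1 - \<eta>))} - {1}) (min_consumer_utility v1 v2 \<alpha>s)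
            \<longleftrightarrow> \<eta> \<ge> 1 / 2)"
proof -
  let ?I = "{0..min (2 * \<eta>) (2 * (1 - \<eta>))}"
  let ?m = "\<lambda>\<beta>. (v2 - v1) * \<alpha>s * (\<beta> * measure unif_market (low_signals v1 v2 \<beta>))"
  let ?g = "\<lambda>\<beta>. \<beta> * ((\<eta> - \<beta> / 2) / (1 - \<beta>))"
  let ?c = "(v2 - v1) * \<alpha>s"
  note v = assms(1,2)
  have \<eta>: "0 < \<eta>" "\<eta> < 1" using assms by auto
  have attained: "?m \<beta> \<in> consumer_utilities v1 v2 \<alpha>s \<beta>"
    and least: "\<And>u. u \<in> consumer_utilities v1 v2 \<alpha>s \<beta> \<Longrightarrow> ?m \<beta> \<le> u"
    if "\<beta> \<in> ?I" for \<beta>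
  proof -
    \<comment> \<open>The two candidate endpoints average to 1, so the smaller is at most 1.\<close>
    have \<beta>: "0 \<le> \<beta>" "\<beta> \<le> 1" using that by auto
    have "\<eta> \<le> 1 - \<beta> / 2" using that by auto
    then have "v1 \<le> v2 * (1 - \<beta> / 2)" using assms by (simp add: field_simps)
    then show "?m \<beta> \<in> consumer_utilities v1 v2 \<alpha>s \<beta>"
      using consumer_utilities_attains[OF v _ _ \<beta>] assms by simp
    show "\<And>u. u \<in> consumer_utilities v1 v2 \<alpha>s \<beta> \<Longrightarrow> ?m \<beta> \<le> u"
      using consumer_utilities_ge[OF v \<beta>] by blast
  qed
  have c: "?c > 0" using assms by simp
  have min_eq: "min_consumer_utility v1 v2 \<alpha>s \<beta> = ?c * ?g \<beta>" if "\<beta> \<in> ?I - {1}" for \<beta>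
  proof -
    have "min_consumer_utility v1 v2 \<alpha>s \<beta> = ?m \<beta>"
      unfolding min_consumer_utility_def
      by (rule Least_equality) (use that attained least in auto)
    also have "\<dots> = ?c * ?g \<beta>"
      using that assms(3) measure_low_signals[OF v, of \<beta>] by auto
    finally show ?thesis .
  qed
  have strict: "strict_mono_on (?I - {1}) (min_consumer_utility v1 v2 \<alpha>s)" if "\<eta> \<ge> 1 / 2"
  proof (rule strict_mono_onI)
    fix a b assume ab: "a \<in> ?I - {1}" "b \<in> ?I - {1}" "a < b"
    then have "1 / (1 - a) \<le> 1 / (1 - b)" by (intro divide_left_mono) auto
    \<comment> \<open>This summand is constant when \<eta> = 1/2; strictness comes from the summand
      \<beta> / 2.\<close>
    then have "(\<eta> - 1 / 2) * (1 / (1 - a) - 1) \<le> (\<eta> - 1 / 2) * (1 / (1 - b) - 1)"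
      using that by (intro mult_left_mono) auto
    moreover have "?g \<beta> = (\<eta> - 1 / 2) * (1 / (1 - \<beta>) - 1) + \<beta> / 2" if "\<beta> < 1" for \<beta>
      using that by (simp add: divide_simps) (simp add: algebra_simps)
    moreover have "a < 1" "b < 1" using ab by auto
    ultimately have "?g a < ?g b" using ab(3) by (simp only:)
    then show "min_consumer_utility v1 v2 \<alpha>s a < min_consumer_utility v1 v2 \<alpha>s b"
      using c ab by (simp only: min_eq mult_strict_left_mono)
  qed
  have not_mono: "\<not> mono_on (?I - {1}) (min_consumer_utility v1 v2 \<alpha>s)" if "\<eta> < 1 / 2"
  proof
    assume "mono_on (?I - {1}) (min_consumer_utility v1 v2 \<alpha>s)"
    \<comment> \<open>Here the interval ends at 2 \<eta> < 1. At that endpoint the noise alone lifts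
      every posterior mean to at least \<eta>, so the low price is never forced.\<close>
    moreover have I: "\<eta> \<in> ?I - {1}" "2 * \<eta> \<in> ?I - {1}" using that \<eta> by auto
    ultimately have "?c * ?g \<eta> \<le> ?c * ?g (2 * \<eta>)"
      using min_eq[OF I(1)] min_eq[OF I(2)] \<eta> mono_onD[of _ _ \<eta> "2 * \<eta>"] by fastforce
    then have "?g \<eta> \<le> ?g (2 * \<eta>)" by (rule mult_left_le_imp_le[OF _ c])
    moreover have "?g (2 * \<eta>) = 0" by simp
    moreover have "?g \<eta> > 0" using \<eta> by (intro mult_pos_pos divide_pos_pos) auto
    ultimately show False by linarith
  qed
  show ?thesis
  proof (intro conjI)
    show "\<forall>\<beta>\<in>?I. \<exists>m\<in>consumer_utilities v1 v2 \<alpha>s \<beta>. \<forall>u\<in>consumer_utilities v1 v2 \<alpha>s \<beta>. m \<le> u"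
      using attained least by blast
    show "mono_on (?I - {1}) (min_consumer_utility v1 v2 \<alpha>s) \<longleftrightarrow> \<eta> \<ge> 1 / 2"
      "strict_mono_on (?I - {1}) (min_consumer_utility v1 v2 \<alpha>s) \<longleftrightarrow> \<eta> \<ge> 1 / 2"
      using strict not_mono strict_mono_on_imp_mono_on[of "?I - {1}" "min_consumer_utility v1 v2 \<alpha>s"]
      by (auto simp only: not_le[symmetric])
  qed
qed

end
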